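(* Let $X=\{P_1,\dots,P_r\}$ be a set of $r$ distinct points of $\mathbb P^n_{\mathbf k}$, not contained in a hyperplane, of socle degree $s$, and let $L_1,\dots,L_r$ be the associated linear forms. Given an integer $u\ge1$ and $\alpha_1,\dots,\alpha_r\in\mathbf k^*$, consider the family of polynomials $F_j=\frac1{(j+u)!}\sum_{i=1}^r\alpha_iL_i^{j+u}$, $j\ge1$. Then for all integers $w\ge1$, all $i=1,\dots,r$ and all $t\ge\max\{s,\,s+w-u\}$ there exists a homogeneous form $\beta_i\in R$ of degree $t+u-w$ such that $$L_i^w=\beta_i\circ F_t.$$
   Context: $\mathbf k$ is an algebraically closed field of characteristic zero, $n\ge1$, $R=\mathbf k[x_0,\dots,x_n]$ (standard graded) and $\Gamma=\mathbf k[y_0,\dots,y_n]$. $R$ acts on $\Gamma$ by differentiation: $f\circ g=f(\partial_{y_0},\dots,\partial_{y_n})(g)$. $I(X)\subset R$ is the homogeneous ideal of $X$. With $\mathrm{HF}_X(t)=\dim_{\mathbf k}(R/I(X))_t$, the socle degree $s$ of $X$ is the largest $t$ with $\mathrm{HF}_X(t)-\mathrm{HF}_X(t-1)\ne0$, equivalently the least $t$ with $\mathrm{HF}_X(t)=r$. The linear form associated to $P=[a_0,\dots,a_n]$ is $L=a_0y_0+\cdots+a_ny_n\in\Gamma$ (for a fixed choice of homogeneous coordinates). *)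

theory Defs
  imports
    "HOL-Library.Poly_Mapping"
    "HOL-Algebra.QuotRing"
    "HOL-Algebra.Embedded_Algebras"
    "HOL-Algebra.Algebraic_Closure_Type"
begin

section \<open>Polynomials in finitely many variables\<close>

text \<open>
  Exponent vectors are finitely supported maps from the variables to \<^typ>\<open>nat\<close>, and
  polynomials are finitely supported maps from exponent vectors to coefficients; the
  product provided by \<^theory>\<open>HOL-Library.Poly_Mapping\<close> is then the usual one. For a finite type
  \<open>'v\<close> with \<open>n + 1\<close> elements this serves both as $R = k[x_0,\dots,x_n]$ and as
  $\Gamma = k[y_0,\dots,y_n]$.
\<close>

abbreviation lookup :: "('a \<Rightarrow>\<^sub>0 'b::zero) \<Rightarrow> 'a \<Rightarrow> 'b" where
  "lookup \<equiv> Poly_Mapping.lookup"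

abbreviation keys :: "('a \<Rightarrow>\<^sub>0 'b::zero) \<Rightarrow> 'a set" where
  "keys \<equiv> Poly_Mapping.keys"

type_synonym ('v, 'k) mpoly = "('v \<Rightarrow>\<^sub>0 nat) \<Rightarrow>\<^sub>0 'k"

definition mconst :: "'k::zero \<Rightarrow> ('v, 'k) mpoly" where
  "mconst c = Poly_Mapping.single 0 c"

definition mvar :: "'v \<Rightarrow> ('v, 'k::zero_neq_one) mpoly" where
  "mvar i = Poly_Mapping.single (Poly_Mapping.single i 1) 1"

definition meval :: "('v::finite, 'k::comm_semiring_1) mpoly \<Rightarrow> ('v \<Rightarrow> 'k) \<Rightarrow> 'k" where
  "meval f a = (\<Sum>m\<in>keys f. lookup f m * (\<Prod>i\<in>UNIV. a i ^ lookup m i))"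

text \<open>The zero polynomial is homogeneous of every degree, so \<open>{f. homogeneous d f}\<close> is $R_d$.\<close>

definition homogeneous :: "nat \<Rightarrow> ('v::finite, 'k::zero) mpoly \<Rightarrow> bool" where
  "homogeneous d f \<longleftrightarrow> (\<forall>m\<in>keys f. (\<Sum>i\<in>UNIV. lookup m i) = d)"

definition linear_form :: "('v::finite \<Rightarrow> 'k::comm_semiring_1) \<Rightarrow> ('v, 'k) mpoly" where
  "linear_form a = (\<Sum>i\<in>UNIV. mconst (a i) * mvar i)"


section \<open>The action by differentiation\<close>

text \<open>
  When the exponent of variable \<open>i\<close> in \<open>m\<close> is zero, the truncated difference of exponents is
  \<open>m\<close>, but the coefficient vanishes.
\<close>

definition partial_deriv :: "'v \<Rightarrow> ('v, 'k::comm_semiring_1) mpoly \<Rightarrow> ('v, 'k) mpoly" where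
  "partial_deriv i g =
     (\<Sum>m\<in>keys g. Poly_Mapping.single (m - Poly_Mapping.single i 1)
        (of_nat (lookup m i) * lookup g m))"

lemma lookup_partial_deriv:
  "lookup (partial_deriv i g) m =
     of_nat (lookup m i + 1) * lookup g (m + Poly_Mapping.single i 1)"
proof -
  let ?e = "Poly_Mapping.single i (1::nat)"
  have iff: "lookup k i = 0 \<or> (k - ?e = m \<longleftrightarrow> k = m + ?e)" for k
  proof (cases "lookup k i = 0")
    case False
    then have "(k - ?e) + ?e = k"
      by (intro poly_mapping_eqI) (auto simp: lookup_add lookup_minus lookup_single when_def)
    moreover have "(m + ?e) - ?e = m"
      by (intro poly_mapping_eqI) (auto simp: lookup_add lookup_minus lookup_single when_def)
    ultimately show ?thesis by metis
  qed simp
  have "lookup (partial_deriv i g) m =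
      (\<Sum>k\<in>keys g. of_nat (lookup k i) * lookup g k when k - ?e = m)"
    by (simp add: partial_deriv_def lookup_sum lookup_single)
  also have "\<dots> = (\<Sum>k\<in>keys g. if k = m + ?e then of_nat (lookup k i) * lookup g k else 0)"
  proof (rule sum.cong)
    fix k
    show "(of_nat (lookup k i) * lookup g k when k - ?e = m) =
        (if k = m + ?e then of_nat (lookup k i) * lookup g k else 0)"
      using iff[of k] by (cases "lookup k i = 0") (auto simp: when_def lookup_add)
  qed simp
  also have "\<dots> = of_nat (lookup m i + 1) * lookup g (m + ?e)"
    by (auto simp: lookup_add lookup_single sum.delta Poly_Mapping.in_keys_iff)
  finally show ?thesis .
qed

lemma partial_deriv_commute:
  "partial_deriv i (partial_deriv j g) = partial_deriv j (partial_deriv i g)"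
  by (intro poly_mapping_eqI)
    (auto simp: lookup_partial_deriv lookup_add lookup_single when_def ac_simps)

text \<open>
  $\partial^m$ is the composition over all variables \<open>i\<close> of the \<open>lookup m i\<close>-fold iterates of
  the partial derivatives. The following lemma makes the fold independent of the order.
\<close>

definition monomial_deriv ::
    "('v::finite \<Rightarrow>\<^sub>0 nat) \<Rightarrow> ('v, 'k::comm_semiring_1) mpoly \<Rightarrow> ('v, 'k) mpoly" where
  "monomial_deriv m g = Finite_Set.fold (\<lambda>i. partial_deriv i ^^ lookup m i) g UNIV"

lemma comp_fun_commute_partial_deriv:
  "comp_fun_commute
     (\<lambda>i. (partial_deriv i :: ('v, 'k::comm_semiring_1) mpoly \<Rightarrow> _) ^^ lookup m i)"
proof
  fix i j :: 'v
  let ?D = "partial_deriv :: 'v \<Rightarrow> ('v, 'k) mpoly \<Rightarrow> _"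
  have one: "?D i ((?D j ^^ b) g) = (?D j ^^ b) (?D i g)" for b g
    by (induction b) (simp_all add: partial_deriv_commute[of i j])
  have "(?D i ^^ a) ((?D j ^^ b) g) = (?D j ^^ b) ((?D i ^^ a) g)" for a b g
    by (induction a) (simp_all add: one)
  then show "(?D j ^^ lookup m j) \<circ> (?D i ^^ lookup m i) =
      (?D i ^^ lookup m i) \<circ> (?D j ^^ lookup m j)"
    by (simp add: fun_eq_iff)
qed

definition diff_action ::
    "('v::finite, 'k::comm_semiring_1) mpoly \<Rightarrow> ('v, 'k) mpoly \<Rightarrow> ('v, 'k) mpoly" where
  "diff_action f g = (\<Sum>m\<in>keys f. mconst (lookup f m) * monomial_deriv m g)"


section \<open>Points of projective space\<close>

text \<open>A point is the set of all its vectors of homogeneous coordinates.\<close>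

definition proj_point :: "('v \<Rightarrow> 'k::field) \<Rightarrow> ('v \<Rightarrow> 'k) set" where
  "proj_point a = {\<lambda>i. c * a i |c. c \<noteq> 0}"

definition proj_space :: "('v \<Rightarrow> 'k::field) set set" where
  "proj_space = {proj_point a |a. a \<noteq> (\<lambda>_. 0)}"

definition hyperplane :: "('v::finite \<Rightarrow> 'k::field) set set \<Rightarrow> bool" where
  "hyperplane H \<longleftrightarrow>
     (\<exists>c. c \<noteq> (\<lambda>_. 0) \<and> H = {P \<in> proj_space. \<forall>a\<in>P. (\<Sum>i\<in>UNIV. c i * a i) = 0})"


section \<open>Hilbert function and socle degree\<close>

abbreviation polyring :: "('v, 'k::comm_ring_1) mpoly ring" where
  "polyring \<equiv> ring_of_type_algebra"

definition vanishing_ideal ::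
    "('v::finite \<Rightarrow> 'k::field) set set \<Rightarrow> ('v, 'k) mpoly set" where
  "vanishing_ideal \<X> =
     Idl\<^bsub>polyring\<^esub> {f. (\<exists>d. homogeneous d f) \<and> (\<forall>P\<in>\<X>. \<forall>a\<in>P. meval f a = 0)}"

text \<open>
  $(R/I(X))_t$ is the image of $R_t$ in $R/I(X)$; its dimension is taken over the image of
  the constants.
\<close>

definition hilbert_fun :: "('v::finite \<Rightarrow> 'k::field) set set \<Rightarrow> nat \<Rightarrow> nat" where
  "hilbert_fun \<X> t =
     (let I = vanishing_ideal \<X>; \<pi> = (\<lambda>f. I +>\<^bsub>polyring\<^esub> f)
      in ring.dim (polyring Quot I) (\<pi> ` range mconst) (\<pi> ` {f. homogeneous t f}))"

text \<open>The Hilbert function is extended by zero to negative arguments.\<close>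

definition hilbert_diff :: "('v::finite \<Rightarrow> 'k::field) set set \<Rightarrow> nat \<Rightarrow> int" where
  "hilbert_diff \<X> t =
     int (hilbert_fun \<X> t) - (if t = 0 then 0 else int (hilbert_fun \<X> (t - 1)))"

definition socle_degree :: "('v::finite \<Rightarrow> 'k::field) set set \<Rightarrow> nat" where
  "socle_degree \<X> = (GREATEST t. hilbert_diff \<X> t \<noteq> 0)"

end

theory Submission
  imports Defs
begin

text \<open>
  A form \<open>f\<close> of degree \<open>d\<close> acts on divided powers by
  $f \circ L_a^{d+w}/(d+w)! = f(a)\, L_a^w/w!$, so it suffices to find, for $d = t + u - w \ge s$,
  a form of degree \<open>d\<close> that vanishes at all points but one. If $S \subseteq X$ is a maximal set of
  points that can be separated by forms of degree \<open>d\<close>, then a form of degree \<open>d\<close> vanishing on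
  \<open>S\<close> vanishes on \<open>X\<close>, so the separators of \<open>S\<close> are a basis of $(R/I(X))_d$ and
  $\mathrm{HF}_X(d) = |S|$. Hence $\mathrm{HF}_X(d) = r$ if and only if all of \<open>X\<close> can be
  separated in degree \<open>d\<close>. Products of linear forms do so in large degrees, and the Hilbert
  function is constant from \<open>s\<close> on. Since the points do not lie in a hyperplane, $s \ge 1$, so
  that $F_t$ is given by its formula.
\<close>


section \<open>Polynomials\<close>

lemma mpoly_induct [case_names single add]:
  fixes f :: "('v, 'k::comm_monoid_add) mpoly"
  assumes single: "\<And>m c. Q (Poly_Mapping.single m c)"
    and add: "\<And>f g. Q f \<Longrightarrow> Q g \<Longrightarrow> Q (f + g)"
  shows "Q f"
proof (induction f rule: Poly_Mapping.update_induct)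
  case const
  show ?case using single[of 0 0] by simp
next
  case (update f m c)
  have "Poly_Mapping.update m c f = f + Poly_Mapping.single m c"
    using update(1)
    by (intro poly_mapping_eqI)
      (auto simp: lookup_update lookup_add lookup_single when_def not_in_keys_iff_lookup_eq_zero)
  then show ?case
    using update(3) single add by metis
qed

lemma mconst_0 [simp]: "mconst 0 = 0"
  and mconst_1 [simp]: "mconst 1 = 1"
  by (simp_all add: mconst_def)

lemma mconst_add: "mconst (c + d) = mconst c + mconst d"
  by (simp add: mconst_def single_add)

lemma mconst_mult: "mconst (c * d) = mconst c * mconst d"
  by (simp add: mconst_def mult_single)

lemma mconst_sum: "mconst (\<Sum>x\<in>S. c x) = (\<Sum>x\<in>S. mconst (c x))"
  by (induction S rule: infinite_finite_induct) (simp_all add: mconst_add)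

lemma meval_single:
  "meval (Poly_Mapping.single m c) a = c * (\<Prod>i\<in>UNIV. a i ^ lookup m i)"
  by (simp add: meval_def)

lemma meval_add: "meval (f + g) a = meval f a + meval g a"
  unfolding meval_def
  by (rule setsum_keys_plus_distrib) (simp_all add: distrib_right)

lemma meval_mult: "meval (f * g) a = meval f a * meval g a"
proof (induction f rule: mpoly_induct)
  case (single m c)
  show ?case
    by (induction g rule: mpoly_induct)
      (simp_all add: mult_single meval_single lookup_add power_add prod.distrib
        meval_add distrib_left mult.left_commute mult.assoc)
qed (simp add: distrib_right meval_add)

lemma meval_mconst [simp]: "meval (mconst c) a = c"
  by (simp add: mconst_def meval_single)

lemma meval_mvar [simp]: "meval (mvar i) a = a i"
proof -
  have "(\<Prod>j\<in>UNIV. a j ^ lookup (Poly_Mapping.single i (1::nat)) j) =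
      (\<Prod>j\<in>UNIV. if j = i then a j else 1)"
    by (rule prod.cong) (auto simp: lookup_single)
  then show ?thesis
    by (simp add: mvar_def meval_single)
qed

lemma meval_0 [simp]: "meval 0 a = 0"
  and meval_1 [simp]: "meval 1 a = 1"
  using meval_mconst[of 0 a] meval_mconst[of 1 a] by simp_all

lemma meval_diff: "meval (f - g) a = meval f a - meval (g :: ('v::finite, 'k::comm_ring_1) mpoly) a"
  using meval_add[of "f - g" g a] by simp

lemma meval_uminus: "meval (- g) a = - meval (g :: ('v::finite, 'k::comm_ring_1) mpoly) a"
  using meval_diff[of 0 g a] by simp

lemma meval_power: "meval (f ^ n) a = meval f a ^ n"
  by (induction n) (simp_all add: meval_mult)

lemma meval_sum: "meval (\<Sum>x\<in>S. f x) a = (\<Sum>x\<in>S. meval (f x) a)"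
  by (induction S rule: infinite_finite_induct) (simp_all add: meval_add)

lemma meval_prod: "meval (\<Prod>x\<in>S. f x) a = (\<Prod>x\<in>S. meval (f x) a)"
  by (induction S rule: infinite_finite_induct) (simp_all add: meval_mult)


lemma homogeneous_0 [simp]: "homogeneous d 0"
  by (simp add: homogeneous_def)

lemma homogeneous_add: "homogeneous d f \<Longrightarrow> homogeneous d g \<Longrightarrow> homogeneous d (f + g)"
  using keys_add[of f g] by (auto simp: homogeneous_def)

lemma homogeneous_sum: "(\<And>x. x \<in> S \<Longrightarrow> homogeneous d (f x)) \<Longrightarrow> homogeneous d (\<Sum>x\<in>S. f x)"
  by (induction S rule: infinite_finite_induct) (simp_all add: homogeneous_add)

lemma homogeneous_mult: "homogeneous d f \<Longrightarrow> homogeneous e g \<Longrightarrow> homogeneous (d + e) (f * g)"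
  using keys_mult[of f g] by (fastforce simp: homogeneous_def lookup_add sum.distrib)

lemma homogeneous_mconst: "homogeneous 0 (mconst c)"
  by (simp add: homogeneous_def mconst_def)

lemma homogeneous_1 [simp]: "homogeneous 0 1"
  by (simp add: homogeneous_def)

lemma homogeneous_mvar: "homogeneous 1 (mvar i)"
  by (simp add: homogeneous_def mvar_def lookup_single when_def)

lemma homogeneous_mconst_mult: "homogeneous d f \<Longrightarrow> homogeneous d (mconst c * f)"
  using homogeneous_mult[OF homogeneous_mconst] by fastforce

lemma homogeneous_diff:
  fixes f g :: "('v::finite, 'k::comm_ring_1) mpoly"
  assumes "homogeneous d f" "homogeneous d g"
  shows "homogeneous d (f - g)"
proof -
  have "f - g = f + mconst (- 1) * g"
    by (simp add: mconst_def single_uminus)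
  then show ?thesis
    using assms by (metis homogeneous_add homogeneous_mconst_mult)
qed

lemma homogeneous_power: "homogeneous d f \<Longrightarrow> homogeneous (n * d) (f ^ n)"
  by (induction n) (simp_all add: homogeneous_mult)

lemma homogeneous_prod:
  "(\<And>x. x \<in> S \<Longrightarrow> homogeneous d (f x)) \<Longrightarrow> homogeneous (card S * d) (\<Prod>x\<in>S. f x)"
  by (induction S rule: infinite_finite_induct) (simp_all add: homogeneous_mult)

lemma meval_scale:
  assumes "homogeneous d f"
  shows "meval f (\<lambda>i. c * a i) = c ^ d * meval f a"
proof -
  have "lookup f m * (\<Prod>i\<in>UNIV. (c * a i) ^ lookup m i) =
      c ^ d * (lookup f m * (\<Prod>i\<in>UNIV. a i ^ lookup m i))" if "m \<in> keys f" for m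
  proof -
    have "(\<Prod>i\<in>UNIV. c ^ lookup m i) = c ^ d"
      using assms that by (simp add: homogeneous_def flip: power_sum)
    then show ?thesis
      by (simp add: power_mult_distrib prod.distrib ac_simps)
  qed
  then show ?thesis
    by (simp add: meval_def sum_distrib_left)
qed


section \<open>Differentiation\<close>

lemma partial_deriv_add: "partial_deriv i (f + g) = partial_deriv i f + partial_deriv i g"
  by (intro poly_mapping_eqI) (simp add: lookup_partial_deriv lookup_add algebra_simps)

lemma partial_deriv_0 [simp]: "partial_deriv i 0 = 0"
  by (simp add: partial_deriv_def)

lemma partial_deriv_sum: "partial_deriv i (\<Sum>x\<in>S. f x) = (\<Sum>x\<in>S. partial_deriv i (f x))"
  by (induction S rule: infinite_finite_induct) (simp_all add: partial_deriv_add)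

lemma partial_deriv_single:
  "partial_deriv i (Poly_Mapping.single m c) =
     Poly_Mapping.single (m - Poly_Mapping.single i 1) (of_nat (lookup m i) * c)"
  by (simp add: partial_deriv_def)

lemma partial_deriv_mult:
  "partial_deriv i (f * g) = partial_deriv i f * g + f * partial_deriv i g"
proof (induction f rule: mpoly_induct)
  case (single m c)
  show ?case
  proof (induction g rule: mpoly_induct)
    case (single m' c')
    let ?e = "Poly_Mapping.single i (1::nat)"
    have shift: "(k + k') - ?e = (k - ?e) + k'" if "lookup k i \<noteq> 0" for k k' :: "'a \<Rightarrow>\<^sub>0 nat"
      using that
      by (intro poly_mapping_eqI) (auto simp: lookup_add lookup_minus lookup_single when_def)
    have "Poly_Mapping.single (m + m' - ?e) (of_nat (lookup m i) * c * c') =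
        Poly_Mapping.single (m - ?e + m') (of_nat (lookup m i) * c * c')"
      using shift[of m m'] by (cases "lookup m i = 0") simp_all
    moreover have "Poly_Mapping.single (m + m' - ?e) (of_nat (lookup m' i) * c * c') =
        Poly_Mapping.single (m + (m' - ?e)) (of_nat (lookup m' i) * c * c')"
      using shift[of m' m] by (cases "lookup m' i = 0") (simp_all add: add.commute)
    ultimately show ?case
      by (simp add: mult_single partial_deriv_single lookup_add distrib_right single_add mult.assoc
          mult.left_commute[of c])
  qed (simp add: distrib_left partial_deriv_add add.assoc add.left_commute)
qed (simp add: distrib_right partial_deriv_add add.assoc add.left_commute)

lemma partial_deriv_mconst [simp]: "partial_deriv i (mconst c) = 0"
  by (simp add: mconst_def partial_deriv_single)

lemma partial_deriv_mvar: "partial_deriv i (mvar j) = (if i = j then 1 else 0)"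
  by (auto simp: mvar_def partial_deriv_single lookup_single)

lemma partial_deriv_linear_form: "partial_deriv i (linear_form a) = mconst (a i)"
  by (simp add: linear_form_def partial_deriv_sum partial_deriv_mult partial_deriv_mvar if_distrib
      cong: if_cong)

lemma partial_deriv_power:
  "partial_deriv i (f ^ Suc n) = of_nat (Suc n) * f ^ n * partial_deriv i f"
  by (induction n) (simp_all add: partial_deriv_mult algebra_simps)

definition divided_power ::
    "nat \<Rightarrow> ('v::finite \<Rightarrow> 'k::field_char_0) \<Rightarrow> ('v, 'k) mpoly" where
  "divided_power N a = mconst (1 / fact N) * linear_form a ^ N"

lemma partial_deriv_divided_power:
  "partial_deriv i (divided_power (Suc N) a) = mconst (a i) * divided_power N a"
proof -
  have "mconst (1 / fact (Suc N)) * of_nat (Suc N) = (mconst (1 / fact N) :: ('a, 'b) mpoly)"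
    by (simp only: mconst_def of_nat_single[THEN fun_cong] comp_def mult_single)
      (simp add: divide_simps del: of_nat_Suc)
  then show ?thesis
    unfolding divided_power_def
    by (simp only: partial_deriv_mult partial_deriv_power partial_deriv_linear_form
        partial_deriv_mconst mult_zero_left add_0_left) (simp only: flip: mult.assoc, simp only: ac_simps)
qed

lemma partial_deriv_iterate_sum_divided_power:
  "(partial_deriv i ^^ k) (\<Sum>j\<in>J. mconst (c j) * divided_power (k + N) (a j)) =
     (\<Sum>j\<in>J. mconst (c j * a j i ^ k) * divided_power N (a j))"
proof (induction k arbitrary: c)
  case (Suc k)
  have "partial_deriv i (\<Sum>j\<in>J. mconst (c j) * divided_power (Suc k + N) (a j)) =
      (\<Sum>j\<in>J. mconst (c j * a j i) * divided_power (k + N) (a j))"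
    by (simp add: partial_deriv_sum partial_deriv_mult partial_deriv_divided_power mconst_mult
        mult.assoc)
  then show ?case
    using Suc[of "\<lambda>j. c j * a j i"] by (simp add: funpow_Suc_right mult.assoc del: funpow.simps)
qed simp

lemma monomial_deriv_sum_divided_power:
  "monomial_deriv m (\<Sum>j\<in>J. mconst (c j) * divided_power ((\<Sum>i\<in>UNIV. lookup m i) + N) (a j)) =
     (\<Sum>j\<in>J. mconst (c j * (\<Prod>i\<in>UNIV. a j i ^ lookup m i)) * divided_power N (a j))"
proof -
  interpret comp_fun_commute "\<lambda>i. (partial_deriv i :: ('a, 'b) mpoly \<Rightarrow> _) ^^ lookup m i"
    by (rule comp_fun_commute_partial_deriv)
  have "Finite_Set.fold (\<lambda>i. partial_deriv i ^^ lookup m i)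
      (\<Sum>j\<in>J. mconst (c j) * divided_power ((\<Sum>i\<in>B. lookup m i) + N) (a j)) B =
      (\<Sum>j\<in>J. mconst (c j * (\<Prod>i\<in>B. a j i ^ lookup m i)) * divided_power N (a j))"
    if "finite B" for B
    using that
  proof (induction B arbitrary: N)
    case (insert i B)
    then show ?case
      using insert.IH[of "lookup m i + N"]
      by (simp add: partial_deriv_iterate_sum_divided_power add.assoc add.left_commute mult.assoc
          mult.commute[of "_ ^ _" "prod _ _"])
  qed simp
  then show ?thesis
    by (simp add: monomial_deriv_def)
qed

lemma diff_action_sum_divided_power:
  assumes "homogeneous d f"
  shows "diff_action f (\<Sum>j\<in>J. mconst (c j) * divided_power (d + N) (a j)) =
    (\<Sum>j\<in>J. mconst (c j * meval f (a j)) * divided_power N (a j))"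
proof -
  have "diff_action f (\<Sum>j\<in>J. mconst (c j) * divided_power (d + N) (a j)) =
      (\<Sum>m\<in>keys f. mconst (lookup f m) *
        (\<Sum>j\<in>J. mconst (c j * (\<Prod>i\<in>UNIV. a j i ^ lookup m i)) * divided_power N (a j)))"
    unfolding diff_action_def
  proof (rule sum.cong)
    fix m assume "m \<in> keys f"
    then have "d = (\<Sum>i\<in>UNIV. lookup m i)"
      using assms by (simp add: homogeneous_def)
    then show "mconst (lookup f m) *
        monomial_deriv m (\<Sum>j\<in>J. mconst (c j) * divided_power (d + N) (a j)) =
      mconst (lookup f m) *
        (\<Sum>j\<in>J. mconst (c j * (\<Prod>i\<in>UNIV. a j i ^ lookup m i)) * divided_power N (a j))"
      by (simp add: monomial_deriv_sum_divided_power)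
  qed simp
  also have "\<dots> = (\<Sum>j\<in>J. \<Sum>m\<in>keys f.
      mconst (c j * (lookup f m * (\<Prod>i\<in>UNIV. a j i ^ lookup m i))) * divided_power N (a j))"
    by (subst sum.swap) (simp add: sum_distrib_left mconst_mult ac_simps)
  also have "\<dots> = (\<Sum>j\<in>J. mconst (c j * meval f (a j)) * divided_power N (a j))"
    by (simp add: meval_def sum_distrib_left mconst_sum sum_distrib_right)
  finally show ?thesis .
qed


section \<open>Separators and the Hilbert function\<close>

lemma ring_of_type_algebra_simps [simp]:
  "carrier ring_of_type_algebra = UNIV"
  "x \<otimes>\<^bsub>ring_of_type_algebra\<^esub> y = x * y"
  "x \<oplus>\<^bsub>ring_of_type_algebra\<^esub> y = x + y"
  "\<one>\<^bsub>ring_of_type_algebra\<^esub> = 1"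
  "\<zero>\<^bsub>ring_of_type_algebra\<^esub> = 0"
  by (simp_all add: ring_of_type_algebra_def)

lemma a_inv_ring_of_type_algebra [simp]:
  "\<ominus>\<^bsub>ring_of_type_algebra\<^esub> y = - (y :: 'a::comm_ring_1)"
proof -
  interpret ring "ring_of_type_algebra :: 'a ring" ..
  show ?thesis
    by (rule minus_equality) simp_all
qed

lemma a_minus_ring_of_type_algebra [simp]:
  "x \<ominus>\<^bsub>ring_of_type_algebra\<^esub> y = x - (y :: 'a::comm_ring_1)"
  by (simp add: a_minus_def)

lemma mconst_ring_hom:
  "ring_hom_ring (ring_of_type_algebra :: 'k::comm_ring_1 ring) polyring mconst"
  by (intro ring_hom_ringI2 ring_hom_memI)
    (auto simp: mconst_add mconst_mult)

lemma ideal_vanishing_ideal: "ideal (vanishing_ideal \<X>) polyring"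
proof -
  interpret ring polyring ..
  show ?thesis
    unfolding vanishing_ideal_def by (rule genideal_ideal) simp
qed

lemma vanishing_idealD:
  fixes \<X> :: "('v::finite \<Rightarrow> 'k::field) set set"
  assumes "f \<in> vanishing_ideal \<X>" "P \<in> \<X>" "a \<in> P"
  shows "meval f a = 0"
proof -
  interpret ring "polyring :: ('v, 'k) mpoly ring" ..
  let ?J = "{f :: ('v, 'k) mpoly. meval f a = 0}"
  have "ideal ?J polyring"
    by (intro idealI ring_axioms add.subgroupI)
      (auto simp: meval_add meval_mult meval_uminus intro: exI[of _ 0])
  then have "vanishing_ideal \<X> \<subseteq> ?J"
    unfolding vanishing_ideal_def using assms(2,3) by (intro genideal_minimal) auto
  then show ?thesis
    using assms(1) by blast
qed

lemma homogeneous_in_vanishing_idealI: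
  fixes \<X> :: "('v::finite \<Rightarrow> 'k::field) set set"
  assumes "homogeneous d f" "\<And>P a. P \<in> \<X> \<Longrightarrow> a \<in> P \<Longrightarrow> meval f a = 0"
  shows "f \<in> vanishing_ideal \<X>"
proof -
  interpret ring "polyring :: ('v, 'k) mpoly ring" ..
  show ?thesis
    unfolding vanishing_ideal_def using assms by (intro subsetD[OF genideal_self]) auto
qed

lemma ex_map_eq:
  assumes "distinct xs" "length ys = length xs" "set ys \<subseteq> f ` UNIV"
  shows "\<exists>c. ys = map (\<lambda>x. f (c x)) xs"
  using assms
proof (induction xs arbitrary: ys)
  case (Cons x xs)
  then obtain y ys' where ys: "ys = y # ys'"
    by (cases ys) auto
  with Cons.prems have "length ys' = length xs" "set ys' \<subseteq> f ` UNIV" "y \<in> f ` UNIV"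
    by auto
  then obtain c z where "ys' = map (\<lambda>x. f (c x)) xs" "y = f z"
    using Cons.IH[of ys'] Cons.prems(1) by auto
  then have "ys = map (\<lambda>w. f ((c(x := z)) w)) (x # xs)"
    using Cons.prems(1) ys by auto
  then show ?case
    by blast
qed simp

locale projective_points =
  fixes A :: "'i set" and a :: "'i \<Rightarrow> 'v::finite \<Rightarrow> 'k::field"
  assumes finite_A: "finite A" and nonempty_A: "A \<noteq> {}"
    and nonzero: "x \<in> A \<Longrightarrow> a x \<noteq> (\<lambda>_. 0)"
    and inj_proj_point: "inj_on (\<lambda>x. proj_point (a x)) A"
begin

abbreviation points :: "('v \<Rightarrow> 'k) set set" where
  "points \<equiv> (\<lambda>x. proj_point (a x)) ` A"

abbreviation I :: "('v, 'k) mpoly set" where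
  "I \<equiv> vanishing_ideal points"

definition separators :: "nat \<Rightarrow> 'i set \<Rightarrow> ('i \<Rightarrow> ('v, 'k) mpoly) \<Rightarrow> bool" where
  "separators d S e \<longleftrightarrow>
     (\<forall>x\<in>S. homogeneous d (e x) \<and> (\<forall>y\<in>S. meval (e x) (a y) = (if x = y then 1 else 0)))"

lemma meval_eq_0_of_in_vanishing_ideal: "f \<in> I \<Longrightarrow> x \<in> A \<Longrightarrow> meval f (a x) = 0"
proof -
  assume "f \<in> I" "x \<in> A"
  moreover have "a x \<in> proj_point (a x)"
    unfolding proj_point_def by (intro CollectI exI[of _ 1]) simp
  ultimately show ?thesis
    by (blast intro: vanishing_idealD)
qed

lemma homogeneous_in_vanishing_ideal_iff:
  assumes "homogeneous d f"
  shows "f \<in> I \<longleftrightarrow> (\<forall>x\<in>A. meval f (a x) = 0)"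
proof
  assume "\<forall>x\<in>A. meval f (a x) = 0"
  then show "f \<in> I"
    using assms
    by (auto intro!: homogeneous_in_vanishing_idealI simp: proj_point_def meval_scale)
qed (simp add: meval_eq_0_of_in_vanishing_ideal)

lemma meval_separators_sum:
  assumes "separators d S e" "T \<subseteq> S" "finite T" "y \<in> S"
  shows "meval (\<Sum>x\<in>T. mconst (c x) * e x) (a y) = (if y \<in> T then c y else 0)"
proof -
  have "meval (\<Sum>x\<in>T. mconst (c x) * e x) (a y) = (\<Sum>x\<in>T. if x = y then c x else 0)"
    unfolding meval_sum
    using assms by (intro sum.cong) (auto simp: meval_mult separators_def)
  then show ?thesis
    using assms(3) by simp
qed

lemma hilbert_fun_eq_card:
  assumes S: "S \<subseteq> A" and e: "separators d S e"
    and determined: "\<And>f. homogeneous d f \<Longrightarrow> \<forall>x\<in>S. meval f (a x) = 0 \<Longrightarrow> \<forall>x\<in>A. meval f (a x) = 0"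
  shows "hilbert_fun points d = card S"
proof -
  let ?R = "polyring :: ('v, 'k) mpoly ring"
  interpret I: ideal I ?R
    by (rule ideal_vanishing_ideal)
  interpret \<pi>: ring_hom_ring ?R "?R Quot I" "\<lambda>f. I +>\<^bsub>?R\<^esub> f"
    by (rule I.rcos_ring_hom_ring)
  let ?\<pi> = "\<lambda>f. I +>\<^bsub>?R\<^esub> f"
  let ?K = "?\<pi> ` range mconst"
  have \<pi>_eq_iff: "?\<pi> f = ?\<pi> g \<longleftrightarrow> f - g \<in> I" for f g
    using I.quotient_eq_iff_same_a_r_cos[OF I.is_ideal, of f g] by simp
  have "1 \<notin> I"
    using meval_eq_0_of_in_vanishing_ideal[of 1] nonempty_A by auto
  then have "?\<pi> \<one>\<^bsub>?R\<^esub> \<noteq> ?\<pi> \<zero>\<^bsub>?R\<^esub>"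
    by (simp add: \<pi>_eq_iff del: \<pi>.hom_one \<pi>.hom_zero)
  then have one_neq_zero: "\<one>\<^bsub>?R Quot I\<^esub> \<noteq> \<zero>\<^bsub>?R Quot I\<^esub>"
    by (simp only: \<pi>.hom_one \<pi>.hom_zero not_False_eq_True)
  have subfield: "subfield ?K (?R Quot I)"
  proof -
    interpret k: Ring.field "ring_of_type_algebra :: 'k ring" ..
    interpret C: ring_hom_ring "ring_of_type_algebra :: 'k ring" ?R mconst
      by (rule mconst_ring_hom)
    have "subfield (range mconst) ?R"
      using C.img_is_subfield(2)[OF k.carrier_is_subfield] by simp
    then show ?thesis
      by (rule \<pi>.img_is_subfield(2)[OF _ one_neq_zero])
  qed
  have combine: "\<pi>.S.combine (map (\<lambda>x. ?\<pi> (mconst (c x))) xs) (map (\<lambda>x. ?\<pi> (e x)) xs) =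
      ?\<pi> (\<Sum>x\<in>set xs. mconst (c x) * e x)" if "distinct xs" for c xs
    using that \<pi>.hom_zero
    by (induction xs) (simp_all del: \<pi>.hom_zero flip: \<pi>.hom_mult \<pi>.hom_add)
  have Span: "p \<in> \<pi>.S.Span ?K (map (\<lambda>x. ?\<pi> (e x)) xs) \<longleftrightarrow>
      (\<exists>c. p = ?\<pi> (\<Sum>x\<in>set xs. mconst (c x) * e x))" (is "?lhs \<longleftrightarrow> ?rhs")
    if distinct: "distinct xs" for xs p
  proof -
    let ?Us = "map (\<lambda>x. ?\<pi> (e x)) xs"
    have "set ?Us \<subseteq> carrier (?R Quot I)"
      by (simp add: image_subset_iff)
    note Span_eq = \<pi>.S.Span_eq_combine_set_length_version[OF subfield this]
    show ?thesis
    proof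
      assume ?lhs
      then obtain Ks where Ks: "p = \<pi>.S.combine Ks ?Us" "length Ks = length ?Us" "set Ks \<subseteq> ?K"
        unfolding Span_eq by blast
      have "length Ks = length xs" "set Ks \<subseteq> range (\<lambda>c. ?\<pi> (mconst c))"
        using Ks(2,3) by (simp_all only: length_map image_image)
      from ex_map_eq[OF distinct this] obtain c where "Ks = map (\<lambda>x. ?\<pi> (mconst (c x))) xs"
        by blast
      then show ?rhs
        using Ks(1) combine[OF distinct] by blast
    next
      assume ?rhs
      then obtain c where "p = \<pi>.S.combine (map (\<lambda>x. ?\<pi> (mconst (c x))) xs) ?Us"
        unfolding combine[OF distinct] by blast
      then show ?lhs
        unfolding Span_eq by (intro CollectI exI conjI) auto
    qed
  qed
  have indep: "\<pi>.S.independent ?K (map (\<lambda>x. ?\<pi> (e x)) xs)"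
    if "distinct xs" "set xs \<subseteq> S" for xs
    using that
  proof (induction xs)
    case (Cons x xs)
    then have distinct: "distinct xs"
      by simp
    have "?\<pi> (e x) \<notin> \<pi>.S.Span ?K (map (\<lambda>x. ?\<pi> (e x)) xs)"
    proof
      assume "?\<pi> (e x) \<in> \<pi>.S.Span ?K (map (\<lambda>x. ?\<pi> (e x)) xs)"
      then obtain c where "e x - (\<Sum>y\<in>set xs. mconst (c y) * e y) \<in> I"
        unfolding Span[OF distinct] \<pi>_eq_iff by blast
      then have "meval (e x - (\<Sum>y\<in>set xs. mconst (c y) * e y)) (a x) = 0"
        using meval_eq_0_of_in_vanishing_ideal Cons.prems(2) S by auto
      moreover have "meval (e x) (a x) = 1"
        using e Cons.prems(2) by (auto simp: separators_def)
      ultimately show False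
        using Cons.prems meval_separators_sum[OF e, of "set xs" x c] by (simp add: meval_diff)
    qed
    then show ?case
      using Cons.IH[OF distinct] Cons.prems(2) unfolding list.map
      by (intro \<pi>.S.independent.li_Cons \<pi>.hom_closed) simp_all
  qed simp
  have finite_S: "finite S"
    using S finite_A finite_subset by blast
  obtain xs where xs: "distinct xs" "set xs = S"
    using finite_distinct_list[OF finite_S] by blast
  have "?\<pi> ` {f. homogeneous d f} = \<pi>.S.Span ?K (map (\<lambda>x. ?\<pi> (e x)) xs)"
  proof (intro equalityI subsetI)
    fix p assume "p \<in> ?\<pi> ` {f. homogeneous d f}"
    then obtain f where f: "homogeneous d f" "p = ?\<pi> f"
      by blast
    let ?g = "\<Sum>x\<in>S. mconst (meval f (a x)) * e x"
    have "homogeneous d (f - ?g)"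
      using f e by (auto intro!: homogeneous_diff homogeneous_sum homogeneous_mconst_mult
          simp: separators_def)
    moreover have "\<forall>y\<in>S. meval (f - ?g) (a y) = 0"
      using meval_separators_sum[OF e _ finite_S] by (simp add: meval_diff)
    ultimately have "f - ?g \<in> I"
      using determined homogeneous_in_vanishing_ideal_iff by blast
    then show "p \<in> \<pi>.S.Span ?K (map (\<lambda>x. ?\<pi> (e x)) xs)"
      unfolding Span[OF xs(1)] xs(2) f(2) \<pi>_eq_iff by (rule exI[of _ "\<lambda>x. meval f (a x)"])
  next
    fix p assume "p \<in> \<pi>.S.Span ?K (map (\<lambda>x. ?\<pi> (e x)) xs)"
    then obtain c where "p = ?\<pi> (\<Sum>x\<in>S. mconst (c x) * e x)"
      unfolding Span[OF xs(1)] xs(2) by blast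
    moreover have "homogeneous d (\<Sum>x\<in>S. mconst (c x) * e x)"
      using e by (auto intro!: homogeneous_sum homogeneous_mconst_mult simp: separators_def)
    ultimately show "p \<in> ?\<pi> ` {f. homogeneous d f}"
      by blast
  qed
  moreover have "length (map (\<lambda>x. ?\<pi> (e x)) xs) = card S"
    using distinct_card[OF xs(1)] xs(2) by simp
  ultimately have "\<pi>.S.dimension (card S) ?K (?\<pi> ` {f. homogeneous d f})"
    using \<pi>.S.dimension_independent[OF indep[OF xs(1) equalityD1[OF xs(2)]]] by (simp only:)
  from \<pi>.S.dimI[OF subfield this] show ?thesis
    by (simp only: hilbert_fun_def over_def Let_def)
qed

lemma ex_hilbert_fun_eq_card:
  obtains S e where "S \<subseteq> A" "separators d S e" "hilbert_fun points d = card S"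
proof -
  define Q where "Q S \<longleftrightarrow> S \<subseteq> A \<and> (\<exists>e. separators d S e)" for S
  have "Q {}"
    by (simp add: Q_def separators_def)
  moreover have "\<forall>S. Q S \<longrightarrow> card S \<le> card A"
    by (simp add: Q_def card_mono finite_A)
  ultimately have "\<exists>S. Q S \<and> (\<forall>T. Q T \<longrightarrow> card T \<le> card S)"
    using ex_has_greatest_nat[of Q "{}" card "Suc (card A)"] by (simp add: less_Suc_eq_le)
  then obtain S e where S: "S \<subseteq> A" "\<And>T. Q T \<Longrightarrow> card T \<le> card S" and e: "separators d S e"
    unfolding Q_def by blast
  have finite_S: "finite S"
    using S(1) finite_A finite_subset by blast
  have "meval f (a z) = 0"
    if f: "homogeneous d f" "\<forall>x\<in>S. meval f (a x) = 0" and z: "z \<in> A" for f z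
  proof (rule ccontr)
    assume neq: "meval f (a z) \<noteq> 0"
    then have "z \<notin> S"
      using f by blast
    define h where "h = mconst (1 / meval f (a z)) * f"
    define e' where "e' x = (if x = z then h else e x - mconst (meval (e x) (a z)) * h)" for x
    have h: "homogeneous d h" "meval h (a z) = 1" "\<forall>x\<in>S. meval h (a x) = 0"
      using f neq by (simp_all add: h_def homogeneous_mconst_mult meval_mult)
    have "separators d (insert z S) e'"
      using e h \<open>z \<notin> S\<close>
      by (auto simp: separators_def e'_def meval_diff meval_mult
          intro!: homogeneous_diff homogeneous_mconst_mult)
    then have "card (insert z S) \<le> card S"
      using S z unfolding Q_def by blast
    then show False
      using \<open>z \<notin> S\<close> finite_S by simp
  qed
  then have "hilbert_fun points d = card S"
    using S(1) by (intro hilbert_fun_eq_card[OF _ e]) simp_all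
  then show thesis
    using that e S(1) by blast
qed

lemma hilbert_fun_eq_card_iff:
  "hilbert_fun points d = card A \<longleftrightarrow> (\<exists>e. separators d A e)"
proof
  assume "hilbert_fun points d = card A"
  then show "\<exists>e. separators d A e"
    using ex_hilbert_fun_eq_card[of d] finite_A by (metis card_subset_eq)
qed (use hilbert_fun_eq_card in blast)

end


section \<open>Forms of large degree\<close>

lemma proj_point_scale:
  fixes b :: "'v \<Rightarrow> 'k::field"
  assumes "c \<noteq> 0"
  shows "proj_point (\<lambda>i. c * b i) = proj_point b"
proof (intro equalityI subsetI)
  fix p assume "p \<in> proj_point (\<lambda>i. c * b i)"
  then obtain c' where "c' \<noteq> 0" "p = (\<lambda>i. c' * (c * b i))"
    by (auto simp: proj_point_def)
  then show "p \<in> proj_point b"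
    using assms unfolding proj_point_def by (intro CollectI exI[of _ "c' * c"]) auto
next
  fix p assume "p \<in> proj_point b"
  then obtain c' where "c' \<noteq> 0" "p = (\<lambda>i. c' * b i)"
    by (auto simp: proj_point_def)
  then show "p \<in> proj_point (\<lambda>i. c * b i)"
    using assms unfolding proj_point_def by (intro CollectI exI[of _ "c' / c"]) auto
qed

context projective_points
begin

lemma ex_separating_linear_form:
  assumes "x \<in> A" "y \<in> A" "x \<noteq> y"
  shows "\<exists>l. homogeneous 1 l \<and> meval l (a x) \<noteq> 0 \<and> meval l (a y) = 0"
proof -
  obtain k where k: "a y k \<noteq> 0"
    using nonzero[OF assms(2)] by auto
  obtain j where j: "a y k * a x j \<noteq> a y j * a x k"
  proof (rule ccontr)
    assume "\<not> thesis"
    then have all: "a y k * a x j = a y j * a x k" for j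
      using that by blast
    have eq: "a x = (\<lambda>j. a x k / a y k * a y j)"
      using all k by (auto simp: fun_eq_iff divide_simps ac_simps)
    moreover have "a x k / a y k \<noteq> 0"
      using eq nonzero[OF assms(1)] by auto
    ultimately have "proj_point (a x) = proj_point (a y)"
      by (metis proj_point_scale)
    then show False
      using inj_proj_point assms by (auto dest: inj_onD)
  qed
  let ?l = "mconst (a y k) * mvar j - mconst (a y j) * mvar k"
  have "homogeneous 1 ?l"
    by (intro homogeneous_diff homogeneous_mconst_mult homogeneous_mvar)
  moreover have "meval ?l (a x) \<noteq> 0" "meval ?l (a y) = 0"
    using j by (simp_all add: meval_diff meval_mult)
  ultimately show ?thesis
    by blast
qed

lemma ex_separators_large:
  assumes "card A \<le> Suc d"
  shows "\<exists>e. separators d A e"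
proof -
  define l where "l x y = (SOME l. homogeneous 1 l \<and> meval l (a x) \<noteq> 0 \<and> meval l (a y) = 0)"
    for x y
  have l: "homogeneous 1 (l x y)" "meval (l x y) (a x) \<noteq> 0" "meval (l x y) (a y) = 0"
    if "x \<in> A" "y \<in> A" "x \<noteq> y" for x y
    using someI_ex[OF ex_separating_linear_form[OF that]] unfolding l_def by blast+
  obtain k where k: "a x (k x) \<noteq> 0" if "x \<in> A" for x
    using nonzero by (metis ext)
  define g where "g x = mvar (k x) ^ (d - card (A - {x})) * (\<Prod>y\<in>A - {x}. l x y)" for x
  define e where "e x = mconst (1 / meval (g x) (a x)) * g x" for x
  have "homogeneous d (g x)" if "x \<in> A" for x
  proof -
    have "homogeneous (card (A - {x}) * 1) (\<Prod>y\<in>A - {x}. l x y)"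
      using that l by (intro homogeneous_prod) auto
    then have "homogeneous ((d - card (A - {x})) * 1 + card (A - {x}) * 1) (g x)"
      unfolding g_def by (intro homogeneous_mult homogeneous_power homogeneous_mvar)
    moreover have "card (A - {x}) \<le> d"
      using assms that finite_A by (simp add: card_Diff_singleton)
    ultimately show ?thesis
      by simp
  qed
  moreover have "meval (g x) (a x) \<noteq> 0" if "x \<in> A" for x
    using that l(2)[OF that] k finite_A
    by (auto simp: g_def meval_mult meval_power meval_prod prod_zero_iff)
  moreover have "meval (g x) (a y) = 0" if "x \<in> A" "y \<in> A" "x \<noteq> y" for x y
  proof -
    have "(\<Prod>z\<in>A - {x}. meval (l x z) (a y)) = 0"
      using that l(3)[OF that] finite_A by (intro prod_zero bexI[of _ y]) auto
    then show ?thesis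
      by (simp add: g_def meval_mult meval_prod)
  qed
  ultimately have "separators d A e"
    by (simp add: separators_def e_def homogeneous_mconst_mult meval_mult)
  then show ?thesis
    by blast
qed

lemma ex_separators_socle_degree:
  assumes "socle_degree points \<le> d"
  shows "\<exists>e. separators d A e"
proof -
  have large: "hilbert_fun points t = card A" if "card A \<le> Suc t" for t
    using that ex_separators_large hilbert_fun_eq_card_iff by blast
  have "hilbert_diff points t = 0" if "card A < t" for t
    using that large[of t] large[of "t - 1"] by (simp add: hilbert_diff_def)
  then have bounded: "\<forall>t. hilbert_diff points t \<noteq> 0 \<longrightarrow> t \<le> card A"
    by (meson not_le)
  have "hilbert_fun points (Suc t) = hilbert_fun points t" if "socle_degree points \<le> t" for t
  proof -
    have "hilbert_diff points (Suc t) = 0"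
      using Greatest_le_nat[of "\<lambda>t. hilbert_diff points t \<noteq> 0" "Suc t" "card A"] bounded that
      unfolding socle_degree_def by force
    then show ?thesis
      by (simp add: hilbert_diff_def)
  qed
  then have "hilbert_fun points (d + m) = hilbert_fun points d" for m
    using assms by (induction m) simp_all
  then have "hilbert_fun points d = card A"
    using large[of "d + card A"] by simp
  then show ?thesis
    using hilbert_fun_eq_card_iff by blast
qed

lemma card_eq_1_of_socle_degree_0:
  assumes "socle_degree points = 0"
  obtains x where "A = {x}"
proof -
  obtain e where e: "separators 0 A e"
    using ex_separators_socle_degree assms by auto
  obtain x where x: "x \<in> A"
    using nonempty_A by blast
  have "y = x" if "y \<in> A" for y
  proof -
    have "homogeneous 0 (e x)"
      using e x by (simp add: separators_def)
    then have "meval (e x) b = meval (e x) (\<lambda>_. 0)" for b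
      using meval_scale[of 0 "e x" 0 b] by simp
    from this[of "a x"] this[of "a y"] have "meval (e x) (a x) = meval (e x) (a y)"
      by simp
    then show ?thesis
      using e x that by (auto simp: separators_def split: if_splits)
  qed
  then show thesis
    using that[of x] x by blast
qed

end

lemma ex_hyperplane_containing:
  fixes b :: "'v::finite \<Rightarrow> 'k::field"
  assumes "card (UNIV :: 'v set) \<ge> 2" "b \<noteq> (\<lambda>_. 0)"
  obtains H where "hyperplane H" "proj_point b \<in> H"
proof -
  obtain k where k: "b k \<noteq> 0"
    using assms(2) by auto
  obtain j where j: "j \<noteq> k"
    using assms(1) card_le_Suc0_iff_eq[of "UNIV :: 'v set"]
    by (metis UNIV_I finite not_less_eq_eq numeral_2_eq_2)
  define c where "c i = (if i = j then b k else if i = k then - b j else 0)" for i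
  let ?H = "{P \<in> proj_space. \<forall>p\<in>P. (\<Sum>i\<in>UNIV. c i * p i) = 0}"
  have "c j \<noteq> 0"
    using k by (simp add: c_def)
  then have "hyperplane ?H"
    unfolding hyperplane_def by (intro exI[of _ c]) auto
  moreover have "(\<Sum>i\<in>UNIV. c i * (z * b i)) = 0" for z
  proof -
    have "(\<Sum>i\<in>UNIV. c i * (z * b i)) = (\<Sum>i\<in>{j, k}. c i * (z * b i))"
      by (rule sum.mono_neutral_right) (auto simp: c_def)
    also have "\<dots> = 0"
      using j by (simp add: c_def)
    finally show ?thesis .
  qed
  then have "proj_point b \<in> ?H"
    using assms(2) by (auto simp: proj_space_def proj_point_def)
  ultimately show thesis
    using that by blast
qed

theorem lemma3p5:
  fixes n r s u :: nat
    and P :: "nat \<Rightarrow> ('v::finite \<Rightarrow> 'k::{alg_closed_field, field_char_0}) set"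
    and \<X> :: "('v \<Rightarrow> 'k) set set"
    and a :: "nat \<Rightarrow> 'v \<Rightarrow> 'k"
    and L F :: "nat \<Rightarrow> ('v, 'k) mpoly"
    and \<alpha> :: "nat \<Rightarrow> 'k"
  assumes "card (UNIV :: 'v set) = n + 1" and "n \<ge> 1"
    and "\<And>i. i \<in> {1..r} \<Longrightarrow> P i \<in> proj_space" and "inj_on P {1..r}"
    and "\<X> = P ` {1..r}"
    and "\<not> (\<exists>H. hyperplane H \<and> \<X> \<subseteq> H)"
    and "s = socle_degree \<X>"
    and "\<And>i. i \<in> {1..r} \<Longrightarrow> a i \<in> P i"
    and "\<And>i. i \<in> {1..r} \<Longrightarrow> L i = linear_form (a i)"
    and "u \<ge> 1"
    and "\<And>i. i \<in> {1..r} \<Longrightarrow> \<alpha> i \<noteq> 0"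
    and "\<And>j. j \<ge> 1 \<Longrightarrow>
           F j = mconst (1 / fact (j + u)) * (\<Sum>i\<in>{1..r}. mconst (\<alpha> i) * L i ^ (j + u))"
  shows "\<forall>w\<ge>1. \<forall>i\<in>{1..r}. \<forall>t. int t \<ge> max (int s) (int s + int w - int u) \<longrightarrow>
           (\<exists>\<beta>. homogeneous (t + u - w) \<beta> \<and> L i ^ w = diff_action \<beta> (F t))"
proof -
  have a: "a i \<noteq> (\<lambda>_. 0)" "proj_point (a i) = P i" if i: "i \<in> {1..r}" for i
  proof -
    obtain b c where b: "b \<noteq> (\<lambda>_. 0)" "P i = proj_point b" "c \<noteq> 0" "a i = (\<lambda>j. c * b j)"
      using assms(3,8)[OF i] by (auto simp: proj_space_def proj_point_def)
    then show "a i \<noteq> (\<lambda>_. 0)"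
      by (auto simp: fun_eq_iff)
    show "proj_point (a i) = P i"
      unfolding b(2,4) by (rule proj_point_scale[OF b(3)])
  qed
  have card: "card (UNIV :: 'v set) \<ge> 2"
    using assms(1,2) by simp
  have "r \<noteq> 0"
  proof
    assume "r = 0"
    moreover obtain H :: "('v \<Rightarrow> 'k) set set" where "hyperplane H"
      using ex_hyperplane_containing[OF card, of "\<lambda>_. 1"] by (auto simp: fun_eq_iff)
    ultimately show False
      using assms(5,6) by auto
  qed
  have \<X>: "(\<lambda>i. proj_point (a i)) ` {1..r} = \<X>"
    using a(2) assms(5) by simp
  have "inj_on (\<lambda>i. proj_point (a i)) {1..r}"
    using inj_on_cong[OF a(2)] assms(4) by (rule iffD2)
  then interpret projective_points "{1..r}" a
    using \<open>r \<noteq> 0\<close> a(1) by unfold_locales simp_all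
  have "s \<noteq> 0"
  proof
    assume "s = 0"
    then obtain i where i: "{1..r} = {i}"
      using card_eq_1_of_socle_degree_0 assms(7) \<X> by metis
    then have "i \<in> {1..r}"
      by simp
    then obtain H where "hyperplane H" "P i \<in> H"
      using ex_hyperplane_containing[OF card] a by metis
    then show False
      using assms(5,6) i by auto
  qed
  show ?thesis
  proof (intro allI ballI impI)
    fix w i t
    assume i: "i \<in> {1..r}" and t: "int t \<ge> max (int s) (int s + int w - int u)"
    define d where "d = t + u - w"
    have d: "socle_degree points \<le> d" "t + u = d + w" "t \<ge> 1"
      using t \<open>s \<noteq> 0\<close> assms(7) unfolding d_def \<X> by linarith+
    obtain e where e: "separators d {1..r} e"
      using ex_separators_socle_degree[OF d(1)] by blast
    define \<beta> where "\<beta> = mconst (fact w / \<alpha> i) * e i"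
    have \<beta>: "homogeneous d \<beta>"
      using e i by (simp add: \<beta>_def separators_def homogeneous_mconst_mult)
    have F: "F t = (\<Sum>j\<in>{1..r}. mconst (\<alpha> j) * divided_power (d + w) (a j))"
      using assms(12)[OF d(3)] assms(9) d(2)
      by (simp add: divided_power_def sum_distrib_left mult.left_commute)
    have "diff_action \<beta> (F t) =
        (\<Sum>j\<in>{1..r}. mconst (\<alpha> j * meval \<beta> (a j)) * divided_power w (a j))"
      unfolding F by (rule diff_action_sum_divided_power[OF \<beta>])
    also have "\<dots> = (\<Sum>j\<in>{1..r}. if j = i then mconst (fact w) * divided_power w (a i) else 0)"
      using e i assms(11)[OF i]
      by (intro sum.cong) (auto simp: \<beta>_def meval_mult separators_def)
    also have "\<dots> = L i ^ w"
      using i assms(9) by (simp add: divided_power_def flip: mult.assoc mconst_mult)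
    finally show "\<exists>\<beta>. homogeneous (t + u - w) \<beta> \<and> L i ^ w = diff_action \<beta> (F t)"
      using \<beta> d_def by metis
  qed
qed

end
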